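(* Let $X$ be a compact metric space with metric $d$, let $T:X\to X$ be a continuous map, and let $\mu$ be an ergodic invariant Borel probability measure of $T$. Then $$h_\mu(T)\geq \overline{\dim}_B(\mu)\cdot E_\mu(T).$$
   Context: A Borel probability measure of $X$ is a $\sigma$-additive measure $\mu$ on the Borel $\sigma$-algebra of $X$ with $\mu(X)=1$. It is invariant (for $T$) if $\mu(T^{-1}(B))=\mu(B)$ for all Borel sets $B\subset X$, and ergodic for $T$ if $\mu(A)\in\{0,1\}$ for all Borel sets $A\subset X$ with $T^{-1}(A)=A$. $B(x,\epsilon)$ denotes the open ball of radius $\epsilon$ centered at $x$. Expansion exponent of $\mu$ with respect to $T$: $$E_\mu(T)=\sup\{\lambda\in\mathbb{R}\mid \exists\,\epsilon>0 \text{ such that } \mu(\{y\in B(x,\epsilon)\mid d(T(x),T(y))<e^\lambda d(x,y)\})=0 \text{ for all } x\in X\},$$ with the convention $\sup\emptyset=-\infty$ (the value lies in $[-\infty,+\infty]$). Upper capacity of $\mu$: $$\overline{\dim}_B(\mu)=\lim_{\delta\to0}\limsup_{\beta\to0}\frac{\log N_\mu(X,\beta,\delta)}{-\log\beta},$$ where $N_\mu(X,\beta,\delta)$ is the minimal number of open balls of radius $\beta$ needed to cover a subset of $X$ of $\mu$-measure bigger than or equal to $1-\delta$ (here $\delta,\beta>0$ tend to $0$ from above). Kolmogorov–Sinai entropy of an invariant measure $\mu$: $$h_\mu(T)=\sup_\alpha\lim_{n\to\infty}\frac1n H_\mu\Big(\bigvee_{i=0}^{n-1}T^{-i}(\alpha)\Big),$$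 where the supremum is over the finite partitions $\alpha$ of $X$ into pairwise disjoint Borel sets with union $X$; $T^{-i}(\alpha)=\{T^{-i}(A)\mid A\in\alpha\}$; $\bigvee_{i=0}^{n-1}\alpha_i=\{A_0\cap\cdots\cap A_{n-1}\mid A_i\in\alpha_i,\ i=0,\dots,n-1\}$; and $H_\mu(\alpha)=-\sum_{A\in\alpha}\mu(A)\log\mu(A)$ with $0\cdot\log 0=0$. The quantities take values in the extended reals, and in the product $0\cdot(\pm\infty)=0$. *)

theory Defs
  imports "HOL-Probability.Probability"
begin

text \<open>
  The ambient space is the whole type \<open>'a\<close>; measures on it are Borel measures, i.e. they satisfy
  \<open>sets \<mu> = sets borel\<close>.
\<close>

definition invariant_measure :: "('a::metric_space \<Rightarrow> 'a) \<Rightarrow> 'a measure \<Rightarrow> bool" where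
  "invariant_measure T \<mu> \<longleftrightarrow> (\<forall>B\<in>sets borel. measure \<mu> (T -` B) = measure \<mu> B)"

definition ergodic_measure :: "('a::metric_space \<Rightarrow> 'a) \<Rightarrow> 'a measure \<Rightarrow> bool" where
  "ergodic_measure T \<mu> \<longleftrightarrow> (\<forall>A\<in>sets borel. T -` A = A \<longrightarrow> measure \<mu> A \<in> {0, 1})"

text \<open>In \<^typ>\<open>ereal\<close> the supremum of the empty set is \<open>-\<infinity>\<close>.\<close>

definition expansion_exponent :: "'a::metric_space measure \<Rightarrow> ('a \<Rightarrow> 'a) \<Rightarrow> ereal" where
  "expansion_exponent \<mu> T =
     Sup {ereal l | l. \<exists>\<epsilon>>0. \<forall>x. measure \<mu> {y \<in> ball x \<epsilon>. dist (T x) (T y) < exp l * dist x y} = 0}"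

text \<open>
  The minimum exists whenever the space is compact and \<open>\<beta> > 0\<close>, \<open>\<delta> \<ge> 0\<close>, since finitely many balls
  then cover everything. Counting centres instead of balls does not change the minimum.
\<close>

definition covering_number :: "'a::metric_space measure \<Rightarrow> real \<Rightarrow> real \<Rightarrow> nat" where
  "covering_number \<mu> \<beta> \<delta> =
     (LEAST n. \<exists>C A. finite C \<and> card C = n \<and> A \<in> sets borel \<and> measure \<mu> A \<ge> 1 - \<delta>
        \<and> A \<subseteq> (\<Union>x\<in>C. ball x \<beta>))"

text \<open>The outer limit exists: the upper limit is antitone in \<open>\<delta>\<close>.\<close>

definition upper_capacity :: "'a::metric_space measure \<Rightarrow> ereal" where
  "upper_capacity \<mu> =
     Lim (at_right 0) (\<lambda>\<delta>. Limsup (at_right 0) (\<lambda>\<beta>.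
       ereal (ln (real (covering_number \<mu> \<beta> \<delta>)) / (- ln \<beta>))))"

definition finite_borel_partition :: "'a::metric_space set set \<Rightarrow> bool" where
  "finite_borel_partition \<alpha> \<longleftrightarrow> finite \<alpha> \<and> \<alpha> \<subseteq> sets borel \<and> disjoint \<alpha> \<and> \<Union>\<alpha> = UNIV"

text \<open>\<open>T\<^sup>-\<^sup>i(\<alpha>)\<close>, and the join of \<open>\<alpha> 0, \<dots>, \<alpha> (n - 1)\<close>.\<close>

definition preimage_partition :: "('a \<Rightarrow> 'a) \<Rightarrow> nat \<Rightarrow> 'a set set \<Rightarrow> 'a set set" where
  "preimage_partition T i \<alpha> = (\<lambda>A. (T ^^ i) -` A) ` \<alpha>"

definition join_partitions :: "nat \<Rightarrow> (nat \<Rightarrow> 'a set set) \<Rightarrow> 'a set set" where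
  "join_partitions n \<alpha> = {\<Inter>i<n. A i | A. \<forall>i<n. A i \<in> \<alpha> i}"

text \<open>For a null set \<open>A\<close> the summand is \<open>0\<close>.\<close>

definition partition_entropy :: "'a measure \<Rightarrow> 'a set set \<Rightarrow> real" where
  "partition_entropy \<mu> \<alpha> = - (\<Sum>A\<in>\<alpha>. measure \<mu> A * ln (measure \<mu> A))"

text \<open>The limit exists, by subadditivity, when \<open>\<mu>\<close> is an invariant probability measure.\<close>

definition KS_entropy :: "'a::metric_space measure \<Rightarrow> ('a \<Rightarrow> 'a) \<Rightarrow> ereal" where
  "KS_entropy \<mu> T =
     (SUP \<alpha>\<in>{\<alpha>. finite_borel_partition \<alpha>}.
        ereal (lim (\<lambda>n. 1 / real n *
          partition_entropy \<mu> (join_partitions n (\<lambda>i. preimage_partition T i \<alpha>)))))"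

end

theory Submission
  imports Defs
begin

text \<open>
  Let \<open>l > 0\<close> be an admissible rate in the expansion exponent, witnessed by the radius \<open>\<epsilon>\<close>, and let \<open>\<alpha>\<close> be a finite
  Borel partition whose members contain only points at distance less than \<open>\<epsilon>\<close> from each other. If two
  points have the same \<open>\<alpha>\<close>-itinerary of length \<open>n\<close>, their orbits stay \<open>\<epsilon>\<close>-close for \<open>n\<close> steps. Apart from null
  sets, their distance grows by the factor \<open>exp l\<close> in each step, so that at the beginning it was less
  than \<open>\<epsilon> * exp (- l * (n - 1))\<close>. Consequently the number of balls of this radius needed to cover most
  of the space is at most the number of itineraries of length \<open>n\<close> needed to cover most of the space
  (\<open>covering_number_le_card_itineraries\<close>).

  The second number grows at most like \<open>exp (n * h)\<close>, where \<open>h\<close> is the entropy of \<open>T\<close> with respect to \<open>\<alpha>\<close>.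
  This is the upper half of the Shannon-McMillan theorem, and \<open>few_itineraries\<close> proves it by counting.
  The function that assigns to \<open>x\<close> the value \<open>- ln\<close> of the measure of its cylinder of length \<open>k\<close> has the entropy of
  itineraries of length \<open>k\<close> as its integral. An ergodic theorem bounds its Birkhoff sums, so most orbits can be cut
  into blocks of length \<open>k\<close> whose measures have a large product. Since the products over all sequences
  of blocks sum to 1, there are few such sequences. The ergodic theorem enters
  as an upper bound for bounded functions, and Garsia's maximal argument gives it in a form that is
  uniform in the length of the sum (\<open>birkhoff_sums_le_on_large_set\<close>).

  Taking logarithms and dividing by \<open>- ln \<beta>\<close>, where \<open>\<beta>\<close> is the radius of the balls, bounds the upper capacity by
  \<open>h / l\<close>. The rates \<open>l \<le> 0\<close> need only that entropy and capacity are nonnegative, and the supremum over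
  all rates is the theorem.
\<close>

section \<open>Averages of subadditive sequences\<close>

text \<open>
  Fekete's argument: the limit is the infimum of the averages. Once one average \<open>a k / k\<close> is close to
  the infimum, division with remainder by \<open>k\<close> carries the estimate over to every large \<open>n\<close>, at the
  cost of a bounded error.
\<close>

lemma convergent_subadditive_average:
  fixes a :: "nat \<Rightarrow> real"
  assumes nonneg: "\<And>n. 0 \<le> a n" and subadd: "\<And>m n. a (m + n) \<le> a m + a n"
  shows "convergent (\<lambda>n. a n / real n)"
proof -
  define L where "L = (INF n\<in>{1..}. a n / real n)"
  have bdd: "bdd_below ((\<lambda>n. a n / real n) ` {1..})"
    by (rule bdd_belowI[of _ 0]) (auto simp: nonneg)
  have lower: "L \<le> a n / real n" if "n \<ge> 1" for n
    unfolding L_def using that by (intro cINF_lower bdd) auto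
  have multiples: "a (q * k + r) \<le> real q * a k + a r" for q k r
  proof (induction q)
    case (Suc q)
    have "a (Suc q * k + r) \<le> a k + a (q * k + r)"
      using subadd[of k "q * k + r"] by (simp add: add.assoc)
    with Suc show ?case by (simp add: algebra_simps)
  qed simp
  have "(\<lambda>n. a n / real n) \<longlonglongrightarrow> L"
  proof (rule order_tendstoI)
    fix c assume c: "c < L"
    show "\<forall>\<^sub>F n in sequentially. c < a n / real n"
      using eventually_ge_at_top[of 1] by eventually_elim (use lower c in \<open>auto intro: less_le_trans\<close>)
  next
    fix c assume "L < c"
    then obtain k where k: "k \<ge> 1" "a k / real k < c"
      unfolding L_def using cINF_less_iff[OF _ bdd, of c] by auto
    define C where "C = (\<Sum>r<k. a r)"
    have le: "a n / real n \<le> a k / real k + C / real n" if "n \<ge> 1" for n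
    proof -
      have "a (n mod k) \<le> C"
        unfolding C_def using k nonneg by (intro member_le_sum) auto
      with multiples[of "n div k" k "n mod k"]
      have "a n \<le> real (n div k) * a k + C" by simp
      also have "\<dots> \<le> (real n / real k) * a k + C"
        by (intro add_right_mono mult_right_mono nonneg of_nat_div_le_of_nat)
      finally show ?thesis
        using that k by (simp add: field_simps)
    qed
    have "(\<lambda>n. a k / real k + C / real n) \<longlonglongrightarrow> a k / real k + 0"
      by (intro tendsto_intros lim_const_over_n)
    then have "\<forall>\<^sub>F n in sequentially. a k / real k + C / real n < c"
      using k by (intro order_tendstoD) auto
    with eventually_ge_at_top[of 1]
    show "\<forall>\<^sub>F n in sequentially. a n / real n < c"
      by eventually_elim (use le in \<open>auto intro: le_less_trans\<close>)
  qed
  then show ?thesis by (rule convergentI)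
qed

section \<open>Measure-preserving maps and Birkhoff sums\<close>

locale measure_preserving_map = prob_space M for M :: "'a measure" +
  fixes T :: "'a \<Rightarrow> 'a"
  assumes space_M [simp]: "space M = UNIV"
    and measurable_T [measurable]: "T \<in> measurable M M"
    and distr_T: "distr M M T = M"

text \<open>
  Natural logarithms, so that entropies agree with \<^const>\<open>partition_entropy\<close>.
\<close>

sublocale measure_preserving_map \<subseteq> information_space M "exp 1"
  by unfold_locales simp

context measure_preserving_map
begin

lemma measurable_iterate [measurable]: "T ^^ n \<in> measurable M M"
  by (induction n) (simp_all add: measurable_comp[OF _ measurable_T])

lemma expectation_shift:
  fixes f :: "'a \<Rightarrow> real"
  assumes [measurable]: "f \<in> borel_measurable M"
  shows "expectation (\<lambda>x. f (T x)) = expectation f"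
  using integral_distr[OF measurable_T assms] by (simp add: distr_T)

lemma prob_shift: "A \<in> sets M \<Longrightarrow> prob (T -` A) = prob A"
  using measure_distr[OF measurable_T, of A] by (simp add: distr_T)

lemma prob_iterate: "A \<in> sets M \<Longrightarrow> prob ((T ^^ n) -` A) = prob A"
proof (induction n arbitrary: A)
  case (Suc n)
  have "T -` A \<in> sets M"
    using measurable_sets[OF measurable_T Suc.prems] by simp
  from Suc.IH[OF this] prob_shift[OF Suc.prems] show ?case
    by (simp add: vimage_def)
qed simp

text \<open>
  The maximum of the Birkhoff sums of \<open>f\<close> of lengths \<open>0, \<dots>, n\<close>. The recursion is the identity on
  which Garsia's proof of the maximal ergodic theorem rests.
\<close>

primrec max_birkhoff :: "('a \<Rightarrow> real) \<Rightarrow> nat \<Rightarrow> 'a \<Rightarrow> real" where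
  "max_birkhoff f 0 x = 0"
| "max_birkhoff f (Suc n) x = max 0 (f x + max_birkhoff f n (T x))"

lemma max_birkhoff_nonneg: "0 \<le> max_birkhoff f n x"
  by (cases n) auto

lemma birkhoff_sum_le_max_birkhoff: "(\<Sum>i<n. f ((T ^^ i) x)) \<le> max_birkhoff f n x"
proof (induction n arbitrary: x)
  case (Suc n)
  have "(\<Sum>i<Suc n. f ((T ^^ i) x)) = f x + (\<Sum>i<n. f ((T ^^ i) (T x)))"
    by (subst sum.lessThan_Suc_shift) (simp add: funpow_swap1)
  with Suc[of "T x"] show ?case by simp
qed simp

lemma max_birkhoff_mono_Suc: "max_birkhoff f n x \<le> max_birkhoff f (Suc n) x"
proof (induction n arbitrary: x)
  case (Suc n)
  from Suc[of "T x"] show ?case by auto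
qed simp

lemma max_birkhoff_mono: "m \<le> n \<Longrightarrow> max_birkhoff f m x \<le> max_birkhoff f n x"
  by (rule lift_Suc_mono_le[where f = "\<lambda>n. max_birkhoff f n x"]) (rule max_birkhoff_mono_Suc)

lemma max_birkhoff_measurable [measurable]:
  assumes [measurable]: "f \<in> borel_measurable M"
  shows "max_birkhoff f n \<in> borel_measurable M"
proof (induction n)
  case 0
  have "max_birkhoff f 0 = (\<lambda>x. 0)" by auto
  then show ?case by simp
next
  case (Suc n)
  note [measurable] = Suc
  have "max_birkhoff f (Suc n) = (\<lambda>x. max 0 (f x + max_birkhoff f n (T x)))" by auto
  then show ?case by simp
qed

lemma max_birkhoff_le:
  assumes "\<And>x. \<bar>f x\<bar> \<le> B"
  shows "max_birkhoff f n x \<le> real n * B"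
proof (induction n arbitrary: x)
  case (Suc n)
  have "0 \<le> B" using assms[of x] by linarith
  then have "0 \<le> real (Suc n) * B" by simp
  moreover have "f x + max_birkhoff f n (T x) \<le> real (Suc n) * B"
    using Suc[of "T x"] assms[of x] by (simp add: algebra_simps)
  ultimately show ?case by simp
qed simp

text \<open>
  Let \<open>\<Phi> n\<close> be the \<open>n\<close>-th running maximum. The points at which \<open>\<Phi> n\<close> is unbounded form an
  invariant set \<open>A\<close>, so \<open>A\<close> has measure 0 or 1. By invariance of the measure, the differences
  \<open>\<Phi> (Suc n) - \<Phi> n \<circ> T\<close> have the same integral as the nonnegative functions
  \<open>\<Phi> (Suc n) - \<Phi> n\<close>. These differences are bounded and equal \<open>f\<close> as soon as \<open>\<Phi> n \<circ> T\<close> is large. If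
  \<open>A\<close> had measure 1, dominated convergence would therefore give a nonnegative integral of \<open>f\<close>.
\<close>

lemma AE_birkhoff_bounded:
  fixes f :: "'a \<Rightarrow> real"
  assumes ergodic: "\<And>A. A \<in> sets M \<Longrightarrow> T -` A = A \<Longrightarrow> prob A = 0 \<or> prob A = 1"
    and f [measurable]: "f \<in> borel_measurable M"
    and B: "\<And>x. \<bar>f x\<bar> \<le> B"
    and neg: "expectation f < 0"
  shows "AE x in M. \<exists>K::nat. \<forall>n. max_birkhoff f n x \<le> real K"
proof -
  define \<Phi> where "\<Phi> = max_birkhoff f"
  have [measurable]: "\<Phi> n \<in> borel_measurable M" for n unfolding \<Phi>_def by measurable
  define A where "A = {x. \<forall>K::nat. \<exists>n. \<Phi> n x > real K}"
  have A_sets: "A \<in> sets M"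
  proof -
    have "{x\<in>space M. \<forall>K::nat. \<exists>n. \<Phi> n x > real K} \<in> sets M" by measurable
    then show ?thesis by (simp add: A_def)
  qed
  have step: "\<Phi> (Suc n) x = max 0 (f x + \<Phi> n (T x))" for n x
    by (simp add: \<Phi>_def)
  have "x \<in> A \<longleftrightarrow> T x \<in> A" for x
  proof
    assume "x \<in> A"
    show "T x \<in> A" unfolding A_def
    proof safe
      fix K :: nat
      obtain K' :: nat where K': "real K + B \<le> real K'" using real_arch_simple by blast
      obtain n where n: "\<Phi> n x > real K'" using \<open>x \<in> A\<close> by (auto simp: A_def)
      then obtain n' where "n = Suc n'" by (cases n) (auto simp: \<Phi>_def)
      with n step[of n' x] B[of x] K' show "\<exists>n. real K < \<Phi> n (T x)"
        by (intro exI[of _ n']) (auto simp: max_def split: if_splits)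
    qed
  next
    assume "T x \<in> A"
    show "x \<in> A" unfolding A_def
    proof safe
      fix K :: nat
      obtain K' :: nat where K': "real K + B \<le> real K'" using real_arch_simple by blast
      obtain n where n: "\<Phi> n (T x) > real K'" using \<open>T x \<in> A\<close> by (auto simp: A_def)
      with step[of n x] B[of x] K' show "\<exists>n. real K < \<Phi> n x"
        by (intro exI[of _ "Suc n"]) auto
    qed
  qed
  then have "T -` A = A" by auto
  then consider "prob A = 0" | "prob A = 1" using ergodic[OF A_sets] by auto
  then show ?thesis
  proof cases
    case 1
    then have "AE x in M. x \<notin> A"
      using A_sets by (simp add: AE_iff_measurable[OF A_sets] emeasure_eq_measure)
    then show ?thesis by eventually_elim (auto simp: A_def \<Phi>_def not_less)
  next
    case 2
    then have AE_A: "AE x in M. x \<in> A" by (simp add: AE_prob_1)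
    \<comment> \<open>This is the difference of \<open>\<Phi> (Suc n)\<close> and \<open>\<Phi> n \<circ> T\<close>, written so that its bounds are visible.\<close>
    define g where "g = (\<lambda>n x. max (- \<Phi> n (T x)) (f x))"
    have [measurable]: "g n \<in> borel_measurable M" for n unfolding g_def by measurable
    have g_eq: "g n x = \<Phi> (Suc n) x - \<Phi> n (T x)" for n x
      unfolding g_def step by (simp add: max_def)
    have int: "integrable M (\<Phi> n)" for n
      by (rule integrable_const_bound[of _ "real n * B"])
         (auto simp: \<Phi>_def max_birkhoff_nonneg max_birkhoff_le[OF B])
    have int_T: "integrable M (\<lambda>x. \<Phi> n (T x))" for n
      by (rule integrable_const_bound[of _ "real n * B"])
         (auto simp: \<Phi>_def max_birkhoff_nonneg max_birkhoff_le[OF B])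
    have "expectation (g n) \<ge> 0" for n
    proof -
      have "expectation (g n) = expectation (\<Phi> (Suc n)) - expectation (\<lambda>x. \<Phi> n (T x))"
        unfolding g_eq by (rule Bochner_Integration.integral_diff[OF int int_T])
      also have "\<dots> = expectation (\<Phi> (Suc n)) - expectation (\<Phi> n)"
        by (simp add: expectation_shift)
      also have "\<dots> \<ge> 0"
        using integral_mono[OF int int, of n "Suc n"] by (simp add: \<Phi>_def max_birkhoff_mono_Suc del: max_birkhoff.simps)
      finally show ?thesis .
    qed
    moreover have "(\<lambda>n. expectation (g n)) \<longlonglongrightarrow> expectation f"
    proof (rule integral_dominated_convergence[where w = "\<lambda>_. B"])
      show "AE x in M. (\<lambda>n. g n x) \<longlonglongrightarrow> f x"
        using AE_A
      proof eventually_elim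
        fix x assume "x \<in> A"
        then have "T x \<in> A" using \<open>T -` A = A\<close> by auto
        obtain K :: nat where K: "B \<le> real K" using real_arch_simple by blast
        obtain N where N: "\<Phi> N (T x) > real K" using \<open>T x \<in> A\<close> by (auto simp: A_def)
        have "g n x = f x" if "n \<ge> N" for n
          using max_birkhoff_mono[OF that, of f "T x"] N K B[of x]
          unfolding g_def \<Phi>_def by (simp add: max_def)
        then have "\<forall>\<^sub>F n in sequentially. g n x = f x"
          using eventually_sequentially by blast
        then show "(\<lambda>n. g n x) \<longlonglongrightarrow> f x" by (rule tendsto_eventually)
      qed
      show "AE x in M. norm (g n x) \<le> B" for n
      proof (rule AE_I2)
        fix x
        show "norm (g n x) \<le> B"
          using B[of x] max_birkhoff_nonneg[of f n "T x"] unfolding g_def \<Phi>_def by (auto simp: max_def)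
      qed
    qed simp_all
    ultimately have "expectation f \<ge> 0" by (intro LIMSEQ_le_const) auto
    with neg show ?thesis by simp
  qed
qed

text \<open>
  The one-sided ergodic theorem in the form needed for counting: the bound is uniform in \<open>x\<close> and \<open>n\<close>
  off a set of small measure. It comes from the almost sure boundedness of the Birkhoff sums of
  \<open>f - a\<close>, whose integral is negative, because the sets on which the bound \<open>K\<close> works increase to a set
  of full measure.
\<close>

lemma birkhoff_sums_le_on_large_set:
  fixes f :: "'a \<Rightarrow> real"
  assumes ergodic: "\<And>A. A \<in> sets M \<Longrightarrow> T -` A = A \<Longrightarrow> prob A = 0 \<or> prob A = 1"
    and f [measurable]: "f \<in> borel_measurable M"
    and B: "\<And>x. \<bar>f x\<bar> \<le> B"
    and a: "expectation f < a" and "\<delta> > 0"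
  obtains K :: nat and G where "G \<in> sets M" "prob G \<ge> 1 - \<delta>"
    "\<And>x n. x \<in> G \<Longrightarrow> (\<Sum>i<n. f ((T ^^ i) x)) \<le> real n * a + real K"
proof -
  define h where "h = (\<lambda>x. f x - a)"
  have [measurable]: "h \<in> borel_measurable M" unfolding h_def by measurable
  have "integrable M f"
    by (rule integrable_const_bound[of _ B]) (auto simp: B)
  then have "expectation h < 0"
    unfolding h_def using a prob_space by simp
  moreover have "\<bar>h x\<bar> \<le> B + \<bar>a\<bar>" for x using B[of x] by (simp add: h_def)
  ultimately have AE: "AE x in M. \<exists>K::nat. \<forall>n. max_birkhoff h n x \<le> real K"
    by (intro AE_birkhoff_bounded[OF ergodic]) auto
  define G where "G = (\<lambda>K::nat. {x. \<forall>n. max_birkhoff h n x \<le> real K})"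
  have G_sets: "G K \<in> sets M" for K
  proof -
    have "{x\<in>space M. \<forall>n. max_birkhoff h n x \<le> real K} \<in> sets M" by measurable
    then show ?thesis by (simp add: G_def)
  qed
  have "(\<lambda>K. prob (G K)) \<longlonglongrightarrow> prob (\<Union>K. G K)"
    by (rule finite_Lim_measure_incseq)
       (use G_sets in \<open>auto simp: incseq_def G_def intro: order_trans\<close>)
  moreover have "prob (\<Union>K. G K) = 1"
    by (subst prob_eq_1) (use G_sets AE in \<open>auto simp: G_def\<close>)
  ultimately have "\<forall>\<^sub>F K in sequentially. 1 - \<delta> < prob (G K)"
    using \<open>\<delta> > 0\<close> by (intro order_tendstoD) auto
  then obtain K where K: "1 - \<delta> < prob (G K)"
    by (auto simp: eventually_sequentially)
  show thesis
  proof (rule that[OF G_sets])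
    show "1 - \<delta> \<le> prob (G K)" using K by simp
    fix x n assume "x \<in> G K"
    then have "(\<Sum>i<n. h ((T ^^ i) x)) \<le> real K"
      using birkhoff_sum_le_max_birkhoff[of h x n] by (auto simp: G_def intro: order_trans)
    then show "(\<Sum>i<n. f ((T ^^ i) x)) \<le> real n * a + real K"
      by (simp add: h_def sum_subtractf)
  qed
qed

section \<open>Entropy of itineraries\<close>

abbreviation entropy_nats :: "('a \<Rightarrow> 'b) \<Rightarrow> real" (\<open>\<H>'(_')\<close>) where
  "\<H>(X) \<equiv> entropy (exp 1) (count_space (X ` space M)) X"

text \<open>
  The function whose integral is the entropy of \<open>X\<close>. On null fibres the convention \<open>ln 0 = 0\<close> makes it
  vanish instead of being infinite.
\<close>

definition self_information :: "('a \<Rightarrow> 'b) \<Rightarrow> 'a \<Rightarrow> real" where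
  "self_information X x = - ln (prob (X -` {X x}))"

lemma self_information_nonneg: "0 \<le> self_information X x"
proof (cases "prob (X -` {X x}) = 0")
  case False
  then have "0 < prob (X -` {X x})" using measure_nonneg[of M "X -` {X x}"] by linarith
  then show ?thesis unfolding self_information_def by (simp add: ln_le_zero_iff)
qed (simp add: self_information_def)

lemma simple_function_self_information:
  assumes "simple_function M X"
  shows "simple_function M (self_information X)"
proof -
  have "self_information X = (\<lambda>w. - ln (prob (X -` {w}))) \<circ> X"
    by (auto simp: self_information_def)
  then show ?thesis using simple_function_compose[OF assms] by metis
qed

lemma self_information_measurable:
  "simple_function M X \<Longrightarrow> self_information X \<in> borel_measurable M"
  by (rule borel_measurable_simple_function[OF simple_function_self_information])

lemma self_information_bounded:
  assumes "simple_function M X"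
  shows "\<exists>B. \<forall>x. \<bar>self_information X x\<bar> \<le> B"
proof -
  have "bounded (range (self_information X))"
    using simple_functionD(1)[OF simple_function_self_information[OF assms]]
    by (simp add: finite_imp_bounded)
  then show ?thesis by (simp add: bounded_iff)
qed

lemma entropy_eq_sum:
  assumes "simple_function M X"
  shows "\<H>(X) = - (\<Sum>w\<in>range X. prob (X -` {w}) * ln (prob (X -` {w})))"
  using entropy_simple_distributed[OF simple_distributedI[OF assms measure_nonneg refl]]
  by (simp add: log_def)

lemma entropy_eq_expectation:
  assumes X: "simple_function M X"
  shows "\<H>(X) = expectation (self_information X)"
proof -
  have fin: "finite (range X)" using simple_functionD(1)[OF X] by simp
  have fiber [measurable]: "X -` {w} \<in> sets M" for w
    using simple_functionD(2)[OF X, of "{w}"] by simp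
  have "self_information X x = (\<Sum>w\<in>range X. indicator (X -` {w}) x * - ln (prob (X -` {w})))" for x
  proof -
    have "(\<Sum>w\<in>range X. indicator (X -` {w}) x * - ln (prob (X -` {w})))
        = (\<Sum>w\<in>range X. if w = X x then self_information X x else 0)"
      by (intro sum.cong) (auto simp: indicator_def self_information_def)
    then show ?thesis using fin by simp
  qed
  then have "expectation (self_information X)
      = expectation (\<lambda>x. \<Sum>w\<in>range X. indicator (X -` {w}) x * - ln (prob (X -` {w})))"
    by (intro Bochner_Integration.integral_cong) auto
  also have "\<dots> = (\<Sum>w\<in>range X. expectation (\<lambda>x. indicator (X -` {w}) x * - ln (prob (X -` {w}))))"
    by (intro Bochner_Integration.integral_sum integrable_mult_left integrable_real_indicator)
       (auto simp: emeasure_eq_measure)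
  also have "\<dots> = (\<Sum>w\<in>range X. prob (X -` {w}) * - ln (prob (X -` {w})))"
    by (intro sum.cong refl, subst Bochner_Integration.integral_mult_left_zero) (simp add: measure_def)
  finally show ?thesis using entropy_eq_sum[OF X] by (simp add: sum_negf)
qed

lemma entropy_nonneg:
  assumes "simple_function M X"
  shows "0 \<le> \<H>(X)"
  unfolding entropy_eq_expectation[OF assms]
  by (rule Bochner_Integration.integral_nonneg) (rule self_information_nonneg)

text \<open>
  Invariance gives corresponding fibres equal measure. The values that \<open>X\<close> takes only outside the range
  of the iterate have null fibres, and these contribute nothing.
\<close>

lemma entropy_iterate:
  assumes X: "simple_function M X"
  shows "\<H>(\<lambda>x. X ((T ^^ n) x)) = \<H>(X)"
proof -
  have fiber: "X -` {w} \<in> sets M" for w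
    using simple_functionD(2)[OF X, of "{w}"] by simp
  have X': "simple_function M (\<lambda>x. X ((T ^^ n) x))"
    by (rule simple_function_comp[OF measurable_iterate X])
  have range_sub: "range (\<lambda>x. X ((T ^^ n) x)) \<subseteq> range X" by auto
  have fin: "finite (range X)" using simple_functionD(1)[OF X] by simp
  have pre: "prob ((\<lambda>x. X ((T ^^ n) x)) -` {w}) = prob (X -` {w})" for w
    using prob_iterate[OF fiber, of n w] by (simp add: vimage_def)
  have zero: "prob (X -` {w}) = 0" if "w \<notin> range (\<lambda>x. X ((T ^^ n) x))" for w
  proof -
    have "(\<lambda>x. X ((T ^^ n) x)) -` {w} = {}" using that by auto
    then show ?thesis using pre[of w] by simp
  qed
  show ?thesis
    unfolding entropy_eq_sum[OF X] entropy_eq_sum[OF X'] pre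
    by (intro arg_cong[where f = uminus] sum.mono_neutral_left fin range_sub) (simp add: zero)
qed

definition itinerary :: "('a \<Rightarrow> 'b) \<Rightarrow> nat \<Rightarrow> 'a \<Rightarrow> 'b list" where
  "itinerary p n x = map (\<lambda>i. p ((T ^^ i) x)) [0..<n]"

lemma length_itinerary [simp]: "length (itinerary p n x) = n"
  by (simp add: itinerary_def)

lemma nth_itinerary: "i < n \<Longrightarrow> itinerary p n x ! i = p ((T ^^ i) x)"
  by (simp add: itinerary_def)

lemma itinerary_eq_iff: "itinerary p n x = itinerary p n y \<longleftrightarrow> (\<forall>i<n. p ((T ^^ i) x) = p ((T ^^ i) y))"
  by (auto simp: itinerary_def)

lemma itinerary_add: "itinerary p (m + n) x = itinerary p m x @ itinerary p n ((T ^^ m) x)"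
proof (rule nth_equalityI)
  fix i assume "i < length (itinerary p (m + n) x)"
  moreover have "(T ^^ i) x = (T ^^ (i - m)) ((T ^^ m) x)" if "\<not> i < m"
    using that funpow_add[of "i - m" m T] by simp
  ultimately show "itinerary p (m + n) x ! i = (itinerary p m x @ itinerary p n ((T ^^ m) x)) ! i"
    by (auto simp: nth_append nth_itinerary)
qed simp

lemma simple_function_itinerary:
  assumes "simple_function M p"
  shows "simple_function M (itinerary p n)"
proof (induction n)
  case 0
  then show ?case by (simp add: itinerary_def)
next
  case (Suc n)
  have "itinerary p (Suc n) = (\<lambda>x. itinerary p n x @ [p ((T ^^ n) x)])"
    by (auto simp: itinerary_def)
  then show ?case
    using simple_function_compose2[OF Suc simple_function_comp[OF measurable_iterate assms, of n], of "\<lambda>u v. u @ [v]"]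
    by simp
qed

text \<open>
  An itinerary of length \<open>m + n\<close> is determined by its first \<open>m\<close> letters and the itinerary of length \<open>n\<close>
  of the \<open>m\<close>-th iterate. Conditioning does not increase entropy, and the second part has the same
  entropy as an itinerary that starts at time 0.
\<close>

lemma entropy_itinerary_subadditive:
  assumes p: "simple_function M p"
  shows "\<H>(itinerary p (m + n)) \<le> \<H>(itinerary p m) + \<H>(itinerary p n)"
proof -
  define X where "X = itinerary p m"
  define Y where "Y = (\<lambda>x. itinerary p n ((T ^^ m) x))"
  have X: "simple_function M X" unfolding X_def by (rule simple_function_itinerary[OF p])
  have Y: "simple_function M Y"
    unfolding Y_def by (rule simple_function_comp[OF measurable_iterate simple_function_itinerary[OF p]])
  have eq: "itinerary p (m + n) = (\<lambda>(u, v). u @ v) \<circ> (\<lambda>x. (X x, Y x))"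
    by (auto simp: X_def Y_def itinerary_add)
  have "\<H>(itinerary p (m + n)) \<le> \<H>(\<lambda>x. (X x, Y x))"
    unfolding eq by (rule entropy_data_processing[OF simple_function_Pair[OF X Y]])
  also have "\<dots> \<le> \<H>(X) + \<H>(Y)"
    using entropy_chain_rule[OF X Y] conditional_entropy_less_eq_entropy[OF Y X] by linarith
  also have "\<H>(Y) = \<H>(itinerary p n)"
    unfolding Y_def by (rule entropy_iterate[OF simple_function_itinerary[OF p]])
  finally show ?thesis by (simp add: X_def)
qed

lemma AE_orbit_avoids_null:
  assumes A: "A \<in> sets M" and null: "prob A = 0"
  shows "AE x in M. \<forall>i. (T ^^ i) x \<notin> A"
  unfolding AE_all_countable
proof
  fix i
  have "(T ^^ i) -` A \<in> null_sets M"
    using measurable_sets[OF measurable_iterate A, of i] prob_iterate[OF A, of i] null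
    by (auto simp: null_sets_def emeasure_eq_measure)
  then show "AE x in M. (T ^^ i) x \<notin> A"
    by (auto dest: AE_not_in)
qed

lemma AE_prob_fiber_pos:
  assumes X: "simple_function M X"
  shows "AE x in M. \<forall>i. 0 < prob (X -` {X ((T ^^ i) x)})"
proof -
  have fin: "finite (range X)" using simple_functionD(1)[OF X] by simp
  have fiber: "X -` {w} \<in> sets M" for w
    using simple_functionD(2)[OF X, of "{w}"] by simp
  define Z where "Z = (\<Union>w\<in>{w \<in> range X. prob (X -` {w}) = 0}. X -` {w})"
  have "Z \<in> null_sets M"
    unfolding Z_def
    by (intro null_sets_UN' countable_finite) (use fin fiber in \<open>auto simp: null_sets_def emeasure_eq_measure\<close>)
  then have "AE x in M. \<forall>i. (T ^^ i) x \<notin> Z"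
    by (intro AE_orbit_avoids_null) (auto simp: null_sets_def measure_def)
  then show ?thesis
    by eventually_elim (auto simp: Z_def zero_less_measure_iff)
qed

end

section \<open>Counting itineraries\<close>

lemma card_image_le_card_image:
  assumes fin: "finite (g ` S)" and factor: "\<And>x y. x \<in> S \<Longrightarrow> y \<in> S \<Longrightarrow> g x = g y \<Longrightarrow> f x = f y"
  shows "finite (f ` S)" "card (f ` S) \<le> card (g ` S)"
proof -
  define h where "h = (\<lambda>b. g (inv_into S f b))"
  have inj: "inj_on h (f ` S)"
    by (rule inj_onI) (metis h_def factor f_inv_into_f inv_into_into)
  have sub: "h ` f ` S \<subseteq> g ` S" by (auto simp: h_def inv_into_into)
  show "finite (f ` S)" using inj_on_finite[OF inj sub fin] .
  show "card (f ` S) \<le> card (g ` S)" using card_inj_on_le[OF inj sub fin] .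
qed

text \<open>
  The products of the weights over all words of length \<open>m\<close> sum to \<open>(sum q V) ^ m \<le> 1\<close>, so at most
  \<open>exp t\<close> of them can be as large as \<open>exp (- t)\<close>.
\<close>

lemma card_products_ge:
  fixes q :: "'b \<Rightarrow> real"
  assumes V: "finite V" and nonneg: "\<And>v. v \<in> V \<Longrightarrow> 0 \<le> q v" and le: "sum q V \<le> 1"
  shows "real (card {w \<in> {..<m::nat} \<rightarrow>\<^sub>E V. exp (- t) \<le> (\<Prod>l<m. q (w l))}) \<le> exp t"
proof -
  let ?P = "{..<m} \<rightarrow>\<^sub>E V" and ?B = "{w \<in> {..<m} \<rightarrow>\<^sub>E V. exp (- t) \<le> (\<Prod>l<m. q (w l))}"
  have fin: "finite ?P" using V by (intro finite_PiE) auto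
  have "real (card ?B) * exp (- t) = (\<Sum>w\<in>?B. exp (- t))" by simp
  also have "\<dots> \<le> (\<Sum>w\<in>?B. \<Prod>l<m. q (w l))" by (intro sum_mono) auto
  also have "\<dots> \<le> (\<Sum>w\<in>?P. \<Prod>l<m. q (w l))"
    by (intro sum_mono2 fin prod_nonneg) (auto intro!: prod_nonneg nonneg dest: PiE_mem)
  also have "\<dots> = (\<Prod>l<m. sum q V)"
    using V by (subst prod_sum_PiE) auto
  also have "\<dots> \<le> 1"
    using le sum_nonneg[of V q] nonneg by (intro prod_le_1) auto
  finally show ?thesis by (simp add: exp_minus field_simps)
qed

text \<open>
  Splitting the times according to their residue \<open>j\<close> modulo \<open>k\<close>, some residue class carries at most its
  share of the main term. The error \<open>K\<close> is not divided.
\<close>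

lemma exists_phase_le_average:
  fixes F :: "nat \<Rightarrow> real"
  assumes k: "k \<ge> 1" and K: "K \<ge> 0" and le: "(\<Sum>i<m * k. F i) \<le> real (m * k) * a + K"
  shows "\<exists>j<k. (\<Sum>l<m. F (l * k + j)) \<le> real m * a + K"
proof (rule ccontr)
  have block: "(\<Sum>j<k. F (l * k + j)) = sum F {l * k..<l * k + k}" for l
    by (rule sum.reindex_bij_witness[of _ "\<lambda>i. i - l * k" "\<lambda>j. l * k + j"]) auto
  assume "\<not> ?thesis"
  then have "(\<Sum>j<k. real m * a + K) < (\<Sum>j<k. \<Sum>l<m. F (l * k + j))"
    using k by (intro sum_strict_mono) (auto simp: not_le lessThan_empty_iff)
  also have "\<dots> = (\<Sum>l<m. \<Sum>j<k. F (l * k + j))" by (rule sum.swap)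
  also have "\<dots> = (\<Sum>l<m. sum F {l * k..<l * k + k})"
    by (simp only: block)
  also have "\<dots> = (\<Sum>i<m * k. F i)" by (rule sum.nat_group)
  finally have "real k * (real m * a + K) < real (m * k) * a + K" using le by simp
  then have "real k * K < K" by (simp add: algebra_simps)
  moreover have "1 * K \<le> real k * K" using k K by (intro mult_right_mono) auto
  ultimately show False by simp
qed

context measure_preserving_map
begin

text \<open>
  The upper half of the Shannon-McMillan theorem, in counting form. On a large set the Birkhoff sums of
  the self-information of the blocks of length \<open>k\<close> are at most \<open>n * a + K\<close>. For every orbit some phase
  \<open>j < k\<close> therefore cuts it into \<open>m\<close> consecutive blocks of length \<open>k\<close> whose probabilities have product at
  least \<open>exp (- (m * a + K))\<close>. There are at most \<open>exp (m * a + K)\<close> such sequences of blocks. Together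
  with the first \<open>j\<close> letters they determine the itinerary, so the phases and the initial letters
  enlarge the count only by a factor that does not depend on \<open>m\<close>.
\<close>

lemma few_itineraries:
  assumes ergodic: "\<And>A. A \<in> sets M \<Longrightarrow> T -` A = A \<Longrightarrow> prob A = 0 \<or> prob A = 1"
    and p: "simple_function M p" and k: "k \<ge> 1"
    and a: "\<H>(itinerary p k) < a" and "\<delta> > 0"
  obtains C G where "C \<ge> 1" "G \<in> sets M" "prob G \<ge> 1 - \<delta>"
    "\<And>m. finite (itinerary p (m * k) ` G)"
    "\<And>m. real (card (itinerary p (m * k) ` G)) \<le> C * exp (real m * a)"
proof -
  define X where "X = itinerary p k"
  define q where "q = (\<lambda>w. prob (X -` {w}))"
  have X: "simple_function M X" unfolding X_def by (rule simple_function_itinerary[OF p])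
  have fin_X: "finite (range X)" using simple_functionD(1)[OF X] by simp
  have fin_p: "finite (range p)" using simple_functionD(1)[OF p] by simp
  have fiber: "X -` {w} \<in> sets M" for w
    using simple_functionD(2)[OF X, of "{w}"] by simp
  obtain B where B: "\<And>x. \<bar>self_information X x\<bar> \<le> B"
    using self_information_bounded[OF X] by blast
  have "expectation (self_information X) < a"
    using a entropy_eq_expectation[OF X] by (simp add: X_def)
  from birkhoff_sums_le_on_large_set[OF ergodic self_information_measurable[OF X] B this \<open>\<delta> > 0\<close>]
  obtain K :: nat and G0 where G0: "G0 \<in> sets M" "prob G0 \<ge> 1 - \<delta>"
    and sums: "\<And>x n. x \<in> G0 \<Longrightarrow> (\<Sum>i<n. self_information X ((T ^^ i) x)) \<le> real n * a + real K"
    by metis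
  from AE_prob_fiber_pos[OF X] obtain N where
    "{x \<in> space M. \<not> (\<forall>i. 0 < prob (X -` {X ((T ^^ i) x)}))} \<subseteq> N" "emeasure M N = 0" "N \<in> sets M"
    by (rule AE_E)
  then have N: "N \<in> null_sets M" "{x. \<not> (\<forall>i. 0 < q (X ((T ^^ i) x)))} \<subseteq> N"
    by (simp_all add: q_def null_setsI)
  \<comment> \<open>Orbits that meet a null fibre are removed, since there the convention \<open>ln 0 = 0\<close> hides a product equal to 0.\<close>
  define G where "G = G0 - N"
  have pos: "0 < q (X ((T ^^ i) x))" if "x \<in> G" for x i using that N(2) by (auto simp: G_def)
  define C where "C = (\<Sum>j<k. real (card (range p) ^ j) * exp (real K))"
  have count: "finite (itinerary p (m * k) ` G) \<and>
      real (card (itinerary p (m * k) ` G)) \<le> C * exp (real m * a)" for m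
  proof -
    define S where "S = (\<lambda>j. {x \<in> G. (\<Sum>l<m. self_information X ((T ^^ (l * k + j)) x)) \<le> real m * a + real K})"
    have G_sub: "G \<subseteq> (\<Union>j<k. S j)"
    proof
      fix x assume "x \<in> G"
      then have "(\<Sum>i<m * k. self_information X ((T ^^ i) x)) \<le> real (m * k) * a + real K"
        by (intro sums) (auto simp: G_def)
      from exists_phase_le_average[OF k _ this] \<open>x \<in> G\<close> show "x \<in> (\<Union>j<k. S j)"
        by (auto simp: S_def)
    qed
    have S_count: "finite (itinerary p (m * k) ` S j) \<and>
        real (card (itinerary p (m * k) ` S j)) \<le> real (card (range p) ^ j) * exp (real K) * exp (real m * a)" for j
    proof -
      define blocks where "blocks = (\<lambda>x. (itinerary p j x, \<lambda>l\<in>{..<m}. X ((T ^^ (l * k + j)) x)))"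
      define W where "W = {w. set w \<subseteq> range p \<and> length w = j}"
      define V where "V = {w \<in> {..<m} \<rightarrow>\<^sub>E range X. exp (- (real m * a + real K)) \<le> (\<Prod>l<m. q (w l))}"
      have fin_W: "finite W" unfolding W_def using fin_p by (rule finite_lists_length_eq)
      have fin_V: "finite V"
        unfolding V_def by (rule finite_subset[OF _ finite_PiE[of "{..<m}" "\<lambda>_. range X"]]) (use fin_X in auto)
      have "(\<Sum>w\<in>range X. q w) = prob (\<Union>w\<in>range X. X -` {w})"
        unfolding q_def by (rule finite_measure_finite_Union[symmetric])
          (use fin_X fiber in \<open>auto simp: disjoint_family_on_def\<close>)
      then have card_V: "real (card V) \<le> exp (real m * a + real K)"
        unfolding V_def by (intro card_products_ge fin_X) (auto simp: q_def)
      have blocks_sub: "blocks ` S j \<subseteq> W \<times> V"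
      proof (rule image_subsetI)
        fix x assume x: "x \<in> S j"
        then have "x \<in> G" by (simp add: S_def)
        have nonzero: "q (X ((T ^^ i) x)) \<noteq> 0" for i
          using pos[OF \<open>x \<in> G\<close>, of i] by simp
        have "(\<Sum>l<m. self_information X ((T ^^ (l * k + j)) x)) = - (\<Sum>l<m. ln (q (X ((T ^^ (l * k + j)) x))))"
          by (simp add: self_information_def q_def sum_negf)
        also have "(\<Sum>l<m. ln (q (X ((T ^^ (l * k + j)) x)))) = ln (\<Prod>l<m. q (X ((T ^^ (l * k + j)) x)))"
          by (rule ln_prod[symmetric]) (simp_all add: nonzero)
        finally have "- (real m * a + real K) \<le> ln (\<Prod>l<m. q (X ((T ^^ (l * k + j)) x)))"
          using x by (simp add: S_def)
        then have "exp (- (real m * a + real K)) \<le> (\<Prod>l<m. q (X ((T ^^ (l * k + j)) x)))"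
          by (subst ln_ge_iff[symmetric]) (simp_all add: prod_pos pos[OF \<open>x \<in> G\<close>])
        moreover have block: "(\<Prod>l<m. q ((\<lambda>l\<in>{..<m}. X ((T ^^ (l * k + j)) x)) l))
            = (\<Prod>l<m. q (X ((T ^^ (l * k + j)) x)))"
          by (rule prod.cong) auto
        ultimately have "(\<lambda>l\<in>{..<m}. X ((T ^^ (l * k + j)) x)) \<in> V"
          unfolding V_def mem_Collect_eq block by auto
        moreover have "itinerary p j x \<in> W"
          by (auto simp: W_def itinerary_def)
        ultimately show "blocks x \<in> W \<times> V" by (simp add: blocks_def)
      qed
      have factor: "itinerary p (m * k) x = itinerary p (m * k) y" if "blocks x = blocks y" for x y
        unfolding itinerary_eq_iff
      proof (intro allI impI)
        fix i assume i: "i < m * k"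
        show "p ((T ^^ i) x) = p ((T ^^ i) y)"
        \<comment> \<open>Time \<open>i\<close> lies among the first \<open>j\<close> letters, or at position \<open>r\<close> of the block number \<open>l\<close>.\<close>
        proof (cases "i < j")
          case True
          then show ?thesis using that by (auto simp: blocks_def itinerary_eq_iff)
        next
          case False
          define l where "l = (i - j) div k"
          define r where "r = (i - j) mod k"
          have "i - j < m * k" using i by simp
          then have l: "l < m" using k unfolding l_def by (simp add: less_mult_imp_div_less)
          have r: "r < k" using k by (simp add: r_def)
          have i_eq: "i = r + (l * k + j)" using False by (simp add: l_def r_def)
          from that have "(\<lambda>l\<in>{..<m}. X ((T ^^ (l * k + j)) x)) l = (\<lambda>l\<in>{..<m}. X ((T ^^ (l * k + j)) y)) l"
            unfolding blocks_def by (metis prod.inject)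
          then have "X ((T ^^ (l * k + j)) x) = X ((T ^^ (l * k + j)) y)" using l by simp
          then show ?thesis
            using r unfolding X_def itinerary_eq_iff i_eq by (simp add: funpow_add)
        qed
      qed
      have fin_blocks: "finite (blocks ` S j)"
        by (rule finite_subset[OF blocks_sub]) (use fin_W fin_V in auto)
      have "card (itinerary p (m * k) ` S j) \<le> card (blocks ` S j)"
        by (rule card_image_le_card_image[OF fin_blocks factor])
      also have "\<dots> \<le> card (W \<times> V)"
        by (rule card_mono[OF _ blocks_sub]) (use fin_W fin_V in auto)
      also have "\<dots> = card (range p) ^ j * card V"
        unfolding W_def by (simp add: card_cartesian_product card_lists_length_eq[OF fin_p])
      finally have "real (card (itinerary p (m * k) ` S j)) \<le> real (card (range p) ^ j) * real (card V)"
        by (metis of_nat_le_iff of_nat_mult)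
      also have "\<dots> \<le> real (card (range p) ^ j) * exp (real m * a + real K)"
        by (intro mult_left_mono card_V) simp
      finally show ?thesis
        using card_image_le_card_image(1)[OF fin_blocks factor] by (simp add: exp_add mult_ac)
    qed
    have sub: "itinerary p (m * k) ` G \<subseteq> (\<Union>j<k. itinerary p (m * k) ` S j)"
      using image_mono[OF G_sub, of "itinerary p (m * k)"] by (simp add: image_UN)
    have fin: "finite (\<Union>j<k. itinerary p (m * k) ` S j)" using S_count by auto
    have "card (itinerary p (m * k) ` G) \<le> card (\<Union>j<k. itinerary p (m * k) ` S j)"
      by (rule card_mono[OF fin sub])
    also have "\<dots> \<le> (\<Sum>j<k. card (itinerary p (m * k) ` S j))"
      by (rule card_UN_le) simp
    finally have "real (card (itinerary p (m * k) ` G)) \<le> (\<Sum>j<k. real (card (itinerary p (m * k) ` S j)))"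
      by (metis of_nat_le_iff of_nat_sum)
    also have "\<dots> \<le> (\<Sum>j<k. real (card (range p) ^ j) * exp (real K) * exp (real m * a))"
      using S_count by (intro sum_mono) auto
    also have "\<dots> = C * exp (real m * a)" by (simp add: C_def sum_distrib_right)
    finally show ?thesis using finite_subset[OF sub fin] by simp
  qed
  show thesis
  proof (rule that)
    have "1 \<le> real (card (range p) ^ 0) * exp (real K)" by simp
    also have "\<dots> \<le> C" unfolding C_def using k by (intro member_le_sum) auto
    finally show "1 \<le> C" .
    show "G \<in> sets M" using G0 N by (auto simp: G_def)
    show "1 - \<delta> \<le> prob G"
      using G0 N by (simp add: G_def measure_Diff_null_set)
  qed (use count in auto)
qed

end

section \<open>Finite Borel partitions and Kolmogorov-Sinai entropy\<close>

definition cell :: "'a set set \<Rightarrow> 'a \<Rightarrow> 'a set" where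
  "cell \<alpha> x = (THE A. A \<in> \<alpha> \<and> x \<in> A)"

lemma mem_iff_cell_eq:
  assumes "finite_borel_partition \<alpha>" "A \<in> \<alpha>"
  shows "x \<in> A \<longleftrightarrow> cell \<alpha> x = A"
proof -
  have "x \<in> \<Union>\<alpha>" using assms(1) by (simp add: finite_borel_partition_def)
  then obtain B where B: "B \<in> \<alpha>" "x \<in> B" by blast
  have unique: "A' = B" if "A' \<in> \<alpha>" "x \<in> A'" for A'
    using that B assms(1) unfolding finite_borel_partition_def disjoint_def by blast
  have "cell \<alpha> x = B"
    unfolding cell_def
  proof (rule the_equality)
    show "B \<in> \<alpha> \<and> x \<in> B" using B by simp
    show "A' = B" if "A' \<in> \<alpha> \<and> x \<in> A'" for A' using unique that by simp
  qed
  then show ?thesis using unique[OF assms(2)] B by blast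
qed

lemma cell_mem: 
  assumes "finite_borel_partition \<alpha>"
  shows "cell \<alpha> x \<in> \<alpha>"
proof -
  have "x \<in> \<Union>\<alpha>" using assms by (simp add: finite_borel_partition_def)
  then obtain B where "B \<in> \<alpha>" "x \<in> B" by blast
  then show ?thesis using mem_iff_cell_eq[OF assms] by metis
qed

text \<open>
  Cover the space by finitely many balls of radius \<open>r / 2\<close> and group the points according to the balls that
  contain them. Points of one group share a ball.
\<close>

lemma exists_fine_partition:
  assumes "compact (UNIV :: 'a::metric_space set)" and "r > 0"
  shows "\<exists>\<alpha> :: 'a set set. finite_borel_partition \<alpha> \<and> (\<forall>A\<in>\<alpha>. \<forall>x\<in>A. \<forall>y\<in>A. dist x y < r)"
proof -
  obtain Q :: "'a set" where Q: "finite Q" "UNIV \<subseteq> (\<Union>c\<in>Q. ball c (r / 2))"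
    using compactE_image[OF assms(1), of UNIV "\<lambda>c. ball c (r / 2)"] \<open>r > 0\<close>
    by (metis UNIV_I UN_I centre_in_ball half_gt_zero open_ball subsetI)
  define near where "near = (\<lambda>x. {c\<in>Q. x \<in> ball c (r / 2)})"
  define \<alpha> where "\<alpha> = range (\<lambda>x. near -` {near x})"
  have "range near \<subseteq> Pow Q" by (auto simp: near_def)
  then have "finite (range near)" using Q(1) by (simp add: finite_subset)
  moreover have "\<alpha> = (\<lambda>D. near -` {D}) ` range near" by (auto simp: \<alpha>_def)
  ultimately have "finite \<alpha>" by simp
  moreover have "near -` {D} \<in> sets borel" for D
  proof (cases "D \<subseteq> Q")
    case True
    have "near y = D \<longleftrightarrow> (\<forall>c\<in>Q. c \<in> D \<longleftrightarrow> y \<in> ball c (r / 2))" for y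
      using True unfolding near_def by blast
    then have "near -` {D} = {y \<in> space borel. \<forall>c\<in>Q. c \<in> D \<longleftrightarrow> y \<in> ball c (r / 2)}"
      by (simp add: vimage_def del: mem_ball)
    also have "\<dots> \<in> sets borel"
    proof (intro sets.sets_Collect_finite_All Q(1))
      fix c :: 'a
      have [measurable]: "ball c (r / 2) \<in> sets borel" by (simp add: borel_open)
      show "{y \<in> space borel. c \<in> D \<longleftrightarrow> y \<in> ball c (r / 2)} \<in> sets borel" by measurable
    qed
    finally show ?thesis .
  next
    case False
    then have "near -` {D} = {}" by (auto simp: near_def)
    then show ?thesis by simp
  qed
  moreover have "disjoint \<alpha>" by (auto simp: disjoint_def \<alpha>_def)
  moreover have "\<Union>\<alpha> = UNIV" by (auto simp: \<alpha>_def)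
  moreover have "dist x y < r" if "A \<in> \<alpha>" "x \<in> A" "y \<in> A" for A x y
  proof -
    from that have eq: "near x = near y" by (auto simp: \<alpha>_def)
    have "x \<in> (\<Union>c\<in>Q. ball c (r / 2))" using Q(2) by blast
    then have "\<exists>c. c \<in> near x" unfolding near_def by blast
    then obtain c where "c \<in> near x" ..
    then have "dist c x < r / 2" "dist c y < r / 2" using eq by (auto simp: near_def)
    then show ?thesis by (metis dist_commute dist_triangle_half_l)
  qed
  ultimately show ?thesis by (intro exI[of _ \<alpha>]) (auto simp: finite_borel_partition_def \<alpha>_def)
qed

section \<open>Expansion and covering numbers\<close>

definition slow_set :: "('a::metric_space \<Rightarrow> 'a) \<Rightarrow> real \<Rightarrow> real \<Rightarrow> 'a \<Rightarrow> 'a set" where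
  "slow_set T l \<epsilon> x = {y \<in> ball x \<epsilon>. dist (T x) (T y) < exp l * dist x y}"

text \<open>
  As long as two orbits stay \<open>\<epsilon>\<close>-close and the second one avoids the exceptional sets of the first one,
  each step multiplies their distance by at least \<open>exp l\<close>.
\<close>

lemma dist_iterates_ge:
  assumes "\<And>i. i < n \<Longrightarrow> dist ((T ^^ i) x) ((T ^^ i) y) < \<epsilon>"
    and "\<And>i. i < n \<Longrightarrow> (T ^^ i) y \<notin> slow_set T l \<epsilon> ((T ^^ i) x)"
    and "j \<le> n"
  shows "exp (l * real j) * dist x y \<le> dist ((T ^^ j) x) ((T ^^ j) y)"
  using \<open>j \<le> n\<close>
proof (induction j)
  case (Suc j)
  then have "exp l * (exp (l * real j) * dist x y) \<le> exp l * dist ((T ^^ j) x) ((T ^^ j) y)"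
    by (intro mult_left_mono) auto
  also have "\<dots> \<le> dist (T ((T ^^ j) x)) (T ((T ^^ j) y))"
    using assms(1,2)[of j] Suc.prems by (auto simp: slow_set_def)
  finally show ?case by (simp add: exp_add algebra_simps)
qed simp

locale borel_measure_preserving_map = measure_preserving_map M T
  for M :: "'a::metric_space measure" and T :: "'a \<Rightarrow> 'a" +
  assumes sets_M: "sets M = sets borel"
begin

lemma slow_set_measurable: "slow_set T l \<epsilon> x \<in> sets M"
proof -
  have T: "T \<in> borel_measurable borel"
    using measurable_T measurable_cong_sets[OF sets_M sets_M] by simp
  have [measurable]: "(\<lambda>y. dist z y) \<in> borel_measurable borel" for z :: 'a
    by (intro borel_measurable_continuous_onI continuous_intros)
  have [measurable]: "(\<lambda>y. dist z (T y)) \<in> borel_measurable borel" for z :: 'a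
    by (rule measurable_compose[OF T]) measurable
  have "{y \<in> space borel. dist x y < \<epsilon> \<and> dist (T x) (T y) < exp l * dist x y} \<in> sets borel"
    by measurable
  then show ?thesis by (simp add: slow_set_def sets_M)
qed

lemma simple_function_cell:
  assumes "finite_borel_partition \<alpha>"
  shows "simple_function M (cell \<alpha>)"
  unfolding simple_function_def
proof (intro conjI ballI)
  have sub: "range (cell \<alpha>) \<subseteq> \<alpha>" using cell_mem[OF assms] by auto
  then show "finite (cell \<alpha> ` space M)"
    using assms by (auto simp: finite_borel_partition_def intro: finite_subset)
  fix A assume "A \<in> cell \<alpha> ` space M"
  then have "A \<in> \<alpha>" using sub by auto
  then have "cell \<alpha> -` {A} = A" using mem_iff_cell_eq[OF assms] by auto
  then show "cell \<alpha> -` {A} \<inter> space M \<in> sets M"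
    using \<open>A \<in> \<alpha>\<close> assms by (auto simp: finite_borel_partition_def sets_M)
qed

text \<open>
  The nonempty members of the join are exactly the fibres of the itinerary map. The empty set may belong
  to the join as well, but it contributes nothing to the entropy.
\<close>

lemma partition_entropy_join:
  assumes \<alpha>: "finite_borel_partition \<alpha>"
  shows "partition_entropy M (join_partitions n (\<lambda>i. preimage_partition T i \<alpha>)) = \<H>(itinerary (cell \<alpha>) n)"
proof -
  define I where "I = itinerary (cell \<alpha>) n"
  define J where "J = join_partitions n (\<lambda>i. preimage_partition T i \<alpha>)"
  have I: "simple_function M I"
    unfolding I_def by (rule simple_function_itinerary[OF simple_function_cell[OF \<alpha>]])
  have fin: "finite (range I)" using simple_functionD(1)[OF I] by simp
  have fiber_mem: "I -` {I x} \<in> J" for x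
  proof -
    have "I -` {I x} = (\<Inter>i<n. (T ^^ i) -` cell \<alpha> ((T ^^ i) x))"
      using mem_iff_cell_eq[OF \<alpha> cell_mem[OF \<alpha>]] by (auto simp: I_def itinerary_eq_iff)
    then show ?thesis
      unfolding J_def join_partitions_def preimage_partition_def using cell_mem[OF \<alpha>]
      by (intro CollectI exI[of _ "\<lambda>i. (T ^^ i) -` cell \<alpha> ((T ^^ i) x)"]) auto
  qed
  have nonempty: "E = I -` {I x}" if "E \<in> J" "x \<in> E" for E x
  proof -
    from \<open>E \<in> J\<close> obtain A where A: "\<And>i. i < n \<Longrightarrow> A i \<in> \<alpha>" "E = (\<Inter>i<n. (T ^^ i) -` A i)"
    proof -
      from \<open>E \<in> J\<close> obtain P where P: "\<forall>i<n. P i \<in> (\<lambda>A. (T ^^ i) -` A) ` \<alpha>" "E = (\<Inter>i<n. P i)"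
        unfolding J_def join_partitions_def preimage_partition_def by blast
      then have "\<forall>i. \<exists>A. i < n \<longrightarrow> A \<in> \<alpha> \<and> P i = (T ^^ i) -` A" by auto
      then obtain A where "\<forall>i. i < n \<longrightarrow> A i \<in> \<alpha> \<and> P i = (T ^^ i) -` A i" by metis
      then show thesis using that[of A] P by auto
    qed
    have cell_eq: "z \<in> A i \<longleftrightarrow> cell \<alpha> z = A i" if "i < n" for i z
      by (rule mem_iff_cell_eq[OF \<alpha> A(1)[OF that]])
    have "cell \<alpha> ((T ^^ i) x) = A i" if "i < n" for i
      using \<open>x \<in> E\<close> that cell_eq[OF that, of "(T ^^ i) x"] by (auto simp: A(2))
    then show ?thesis
      using cell_eq by (auto simp: A(2) I_def itinerary_eq_iff)
  qed
  have J_diff: "J - {{}} = (\<lambda>w. I -` {w}) ` range I"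
  proof (intro equalityI subsetI)
    fix E assume "E \<in> J - {{}}"
    then obtain x where "x \<in> E" by auto
    then show "E \<in> (\<lambda>w. I -` {w}) ` range I" using nonempty[of E x] \<open>E \<in> J - {{}}\<close> by auto
  next
    fix E assume "E \<in> (\<lambda>w. I -` {w}) ` range I"
    then obtain x where "E = I -` {I x}" by auto
    then show "E \<in> J - {{}}" using fiber_mem[of x] by auto
  qed
  then have "finite (J - {{}})" using fin by simp
  then have fin_J: "finite J" by simp
  have "(\<Sum>E\<in>J. measure M E * ln (measure M E)) = (\<Sum>E\<in>J - {{}}. measure M E * ln (measure M E))"
    by (intro sum.mono_neutral_right fin_J) auto
  also have "\<dots> = (\<Sum>w\<in>range I. prob (I -` {w}) * ln (prob (I -` {w})))"
    unfolding J_diff by (subst sum.reindex) (auto simp: inj_on_def)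
  finally show ?thesis
    using entropy_eq_sum[OF I] by (simp add: partition_entropy_def I_def J_def)
qed

lemma KS_entropy_ge:
  assumes \<alpha>: "finite_borel_partition \<alpha>"
  obtains h where "(\<lambda>n. \<H>(itinerary (cell \<alpha>) n) / real n) \<longlonglongrightarrow> h" "0 \<le> h" "ereal h \<le> KS_entropy M T"
proof -
  note simple = simple_function_itinerary[OF simple_function_cell[OF \<alpha>]]
  have "convergent (\<lambda>n. \<H>(itinerary (cell \<alpha>) n) / real n)"
    by (rule convergent_subadditive_average)
      (rule entropy_nonneg[OF simple], rule entropy_itinerary_subadditive[OF simple_function_cell[OF \<alpha>]])
  then obtain h where h: "(\<lambda>n. \<H>(itinerary (cell \<alpha>) n) / real n) \<longlonglongrightarrow> h"
    by (auto simp: convergent_def)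
  then have "0 \<le> h"
    by (rule LIMSEQ_le_const) (use entropy_nonneg[OF simple] in auto)
  have "ereal (lim (\<lambda>n. 1 / real n * partition_entropy M (join_partitions n (\<lambda>i. preimage_partition T i \<alpha>))))
      \<le> KS_entropy M T"
    unfolding KS_entropy_def using \<alpha> by (intro SUP_upper) auto
  also have "lim (\<lambda>n. 1 / real n * partition_entropy M (join_partitions n (\<lambda>i. preimage_partition T i \<alpha>))) = h"
    by (rule limI) (use h in \<open>simp add: partition_entropy_join[OF \<alpha>]\<close>)
  finally show thesis using that h \<open>0 \<le> h\<close> by blast
qed

text \<open>
  Choose one point of \<open>G\<close> for each itinerary that occurs in \<open>G\<close>. A point with the same itinerary stays
  \<open>\<epsilon>\<close>-close to the chosen one during \<open>n\<close> steps, so by expansion it was exponentially close at the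
  beginning, unless it lies in one of finitely many null sets. Hence the balls of radius \<open>\<beta>\<close> around
  the chosen points cover \<open>G\<close> up to a null set.
\<close>

lemma covering_number_le_card_itineraries:
  assumes fine: "\<And>x y. p x = p y \<Longrightarrow> dist x y < \<epsilon>"
    and null: "\<And>x. prob (slow_set T l \<epsilon> x) = 0"
    and G: "G \<in> sets M" "prob G \<ge> 1 - \<delta>" and fin: "finite (itinerary p n ` G)"
    and n: "n \<ge> 1" and \<beta>: "\<epsilon> * exp (- (l * (real n - 1))) \<le> \<beta>"
  shows "covering_number M \<beta> \<delta> \<le> card (itinerary p n ` G)"
proof -
  define Q where "Q = inv_into G (itinerary p n) ` itinerary p n ` G"
  define S where "S = (\<Union>c\<in>Q. \<Union>i<n. (T ^^ i) -` slow_set T l \<epsilon> ((T ^^ i) c))"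
  have fin_Q: "finite Q" using fin by (simp add: Q_def)
  have "(T ^^ i) -` slow_set T l \<epsilon> z \<in> null_sets M" for i z
    using measurable_sets[OF measurable_iterate slow_set_measurable, of i l \<epsilon> z]
      prob_iterate[OF slow_set_measurable, of i l \<epsilon> z] null[of z]
    by (auto simp: null_sets_def emeasure_eq_measure)
  then have S: "S \<in> null_sets M"
    unfolding S_def using fin_Q by (intro null_sets_UN' countable_finite) auto
  have "G - S \<subseteq> (\<Union>c\<in>Q. ball c \<beta>)"
  proof
    fix y assume y: "y \<in> G - S"
    define c where "c = inv_into G (itinerary p n) (itinerary p n y)"
    have "c \<in> Q" using y by (auto simp: Q_def c_def)
    have "itinerary p n c = itinerary p n y"
      unfolding c_def using y by (intro f_inv_into_f) auto
    then have close: "dist ((T ^^ i) c) ((T ^^ i) y) < \<epsilon>" if "i < n" for i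
      using that fine by (simp add: itinerary_eq_iff)
    have "exp (l * real (n - 1)) * dist c y \<le> dist ((T ^^ (n - 1)) c) ((T ^^ (n - 1)) y)"
    proof (rule dist_iterates_ge)
      show "(T ^^ i) y \<notin> slow_set T l \<epsilon> ((T ^^ i) c)" if "i < n" for i
        using y \<open>c \<in> Q\<close> that by (auto simp: S_def)
    qed (use close in auto)
    also have "\<dots> < \<epsilon>" using close[of "n - 1"] n by simp
    finally have "exp (l * (real n - 1)) * dist c y < \<epsilon>" using n by (simp add: of_nat_diff)
    then have "dist c y < \<epsilon> * exp (- (l * (real n - 1)))"
      unfolding exp_minus by (simp add: divide_inverse[symmetric] pos_less_divide_eq mult.commute)
    then have "dist c y < \<beta>" using \<beta> by (rule less_le_trans)
    then show "y \<in> (\<Union>c\<in>Q. ball c \<beta>)" using \<open>c \<in> Q\<close> by auto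
  qed
  moreover have "G - S \<in> sets borel" using G S by (auto simp: sets_M[symmetric])
  moreover have "measure M (G - S) \<ge> 1 - \<delta>" using G S by (simp add: measure_Diff_null_set)
  ultimately have "covering_number M \<beta> \<delta> \<le> card Q"
    unfolding covering_number_def using fin_Q by (intro Least_le) blast
  also have "\<dots> \<le> card (itinerary p n ` G)" unfolding Q_def by (rule card_image_le[OF fin])
  finally show ?thesis .
qed

text \<open>
  Expansion turns itineraries of length about \<open>- ln \<beta> / l\<close> into a cover by balls of radius \<open>\<beta>\<close>. Rounding
  this length up to a multiple \<open>m * k\<close> costs a bounded factor, and the number of itineraries grows like
  \<open>exp (m * a)\<close>.
\<close>

lemma Limsup_covering_number_le_block:
  assumes ergodic: "\<And>A. A \<in> sets M \<Longrightarrow> T -` A = A \<Longrightarrow> prob A = 0 \<or> prob A = 1"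
    and p: "simple_function M p" and fine: "\<And>x y. p x = p y \<Longrightarrow> dist x y < \<epsilon>"
    and null: "\<And>x. prob (slow_set T l \<epsilon> x) = 0"
    and "l > 0" and "\<epsilon> > 0" and "\<delta> > 0" and k: "k \<ge> 1" and a: "\<H>(itinerary p k) < a"
  shows "Limsup (at_right 0) (\<lambda>\<beta>. ereal (ln (real (covering_number M \<beta> \<delta>)) / (- ln \<beta>)))
      \<le> ereal (a / (real k * l))"
proof -
  from few_itineraries[OF ergodic p k a \<open>\<delta> > 0\<close>]
  obtain C G where C: "C \<ge> 1" and G: "G \<in> sets M" "prob G \<ge> 1 - \<delta>"
    and fin: "\<And>m. finite (itinerary p (m * k) ` G)"
    and card: "\<And>m. real (card (itinerary p (m * k) ` G)) \<le> C * exp (real m * a)"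
    by metis
  have "a \<ge> 0" using entropy_nonneg[OF simple_function_itinerary[OF p], of k] a by linarith
  define D where "D = ln C + a * ((ln \<epsilon> / l + 1) / real k + 1)"
  have bound: "ln (real (covering_number M \<beta> \<delta>)) / (- ln \<beta>) \<le> D / (- ln \<beta>) + a / (real k * l)"
    if \<beta>: "0 < \<beta>" "\<beta> < min 1 \<epsilon>" for \<beta>
  proof -
    define s where "s = ln (\<epsilon> / \<beta>) / l"
    have "s > 0" unfolding s_def using \<beta> \<open>l > 0\<close> by (intro divide_pos_pos ln_gt_zero) auto
    \<comment> \<open>The least \<open>m\<close> with \<open>m * k - 1 \<ge> s\<close>: \<open>n\<close> letters control only \<open>n - 1\<close> expansion steps.\<close>
    define m where "m = nat \<lceil>(s + 1) / real k\<rceil>"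
    have pos: "0 \<le> (s + 1) / real k" using \<open>s > 0\<close> by simp
    have "(s + 1) / real k \<le> real m" unfolding m_def by (rule real_nat_ceiling_ge)
    then have mk: "s + 1 \<le> real (m * k)" using k by (simp add: field_simps)
    have m_le: "real m \<le> (s + 1) / real k + 1"
      unfolding m_def using of_nat_ceiling[of "(s + 1) / real k"] pos by linarith
    have "real (m * k) \<ge> 1" using mk \<open>s > 0\<close> by linarith
    then have "m * k \<ge> 1" by linarith
    have "ln (\<epsilon> / \<beta>) \<le> l * (real (m * k) - 1)"
      using mk \<open>l > 0\<close> by (simp add: s_def field_simps)
    then have "\<epsilon> * exp (- (l * (real (m * k) - 1))) \<le> \<epsilon> * exp (- ln (\<epsilon> / \<beta>))"
      using \<open>\<epsilon> > 0\<close> by (intro mult_left_mono) auto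
    also have "\<dots> = \<beta>" using \<beta> \<open>\<epsilon> > 0\<close> by (simp add: exp_minus)
    finally have radius: "\<epsilon> * exp (- (l * (real (m * k) - 1))) \<le> \<beta>" .
    have "covering_number M \<beta> \<delta> \<le> card (itinerary p (m * k) ` G)"
      by (rule covering_number_le_card_itineraries[OF fine null G fin \<open>m * k \<ge> 1\<close> radius])
    then have N: "real (covering_number M \<beta> \<delta>) \<le> C * exp (real m * a)"
      using card[of m] by linarith
    have "ln (real (covering_number M \<beta> \<delta>)) \<le> ln C + real m * a"
    \<comment> \<open>For \<open>\<delta> \<ge> 1\<close> the covering number is 0, and then \<open>ln 0 = 0\<close>.\<close>
    proof (cases "covering_number M \<beta> \<delta> = 0")
      case True
      then show ?thesis using C \<open>a \<ge> 0\<close> by simp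
    next
      case False
      then have "ln (real (covering_number M \<beta> \<delta>)) \<le> ln (C * exp (real m * a))"
        using N by (intro ln_mono) auto
      also have "\<dots> = ln C + real m * a" using C by (simp add: ln_mult)
      finally show ?thesis .
    qed
    also have "\<dots> \<le> ln C + ((s + 1) / real k + 1) * a"
      using m_le \<open>a \<ge> 0\<close> by (intro add_left_mono mult_right_mono)
    also have "\<dots> = D + a / (real k * l) * (- ln \<beta>)"
      unfolding D_def s_def using \<beta> \<open>\<epsilon> > 0\<close> \<open>l > 0\<close> k by (simp add: ln_div field_simps)
    finally show ?thesis using \<beta> ln_less_zero[of \<beta>] by (simp add: field_simps)
  qed
  have "Limsup (at_right 0) (\<lambda>\<beta>. ereal (ln (real (covering_number M \<beta> \<delta>)) / (- ln \<beta>)))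
      \<le> Limsup (at_right 0) (\<lambda>\<beta>. ereal (D / (- ln \<beta>) + a / (real k * l)))"
  proof (rule Limsup_mono)
    have "\<forall>\<^sub>F \<beta> in at_right 0. \<beta> \<in> {0<..<min 1 \<epsilon>}"
      using \<open>\<epsilon> > 0\<close> by (intro eventually_at_right_real) auto
    then show "\<forall>\<^sub>F \<beta> in at_right 0. ereal (ln (real (covering_number M \<beta> \<delta>)) / (- ln \<beta>))
        \<le> ereal (D / (- ln \<beta>) + a / (real k * l))"
      by eventually_elim (use bound in auto)
  qed
  also have "\<dots> = ereal (a / (real k * l))"
  proof (rule lim_imp_Limsup)
    have "filterlim (\<lambda>\<beta>::real. - ln \<beta>) at_top (at_right 0)"
      using ln_at_0 by (simp add: filterlim_uminus_at_top)
    then have "((\<lambda>\<beta>. D / (- ln \<beta>)) \<longlongrightarrow> 0) (at_right 0)"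
      by (intro tendsto_divide_0[OF tendsto_const] filterlim_at_top_imp_at_infinity)
    then have "((\<lambda>\<beta>. D / (- ln \<beta>) + a / (real k * l)) \<longlongrightarrow> 0 + a / (real k * l)) (at_right 0)"
      by (intro tendsto_add tendsto_const)
    then show "((\<lambda>\<beta>. ereal (D / (- ln \<beta>) + a / (real k * l))) \<longlongrightarrow> ereal (a / (real k * l))) (at_right 0)"
      by simp
  qed simp
  finally show ?thesis .
qed

text \<open>
  Any number above \<open>h / l\<close> exceeds the bound that some block length \<open>k\<close> gives, because the averages
  converge to \<open>h\<close>; the gap leaves room for the strict inequality that the bound for blocks requires.
\<close>

lemma Limsup_covering_number_le:
  assumes ergodic: "\<And>A. A \<in> sets M \<Longrightarrow> T -` A = A \<Longrightarrow> prob A = 0 \<or> prob A = 1"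
    and p: "simple_function M p" and fine: "\<And>x y. p x = p y \<Longrightarrow> dist x y < \<epsilon>"
    and null: "\<And>x. prob (slow_set T l \<epsilon> x) = 0"
    and "l > 0" and "\<epsilon> > 0" and "\<delta> > 0"
    and h: "(\<lambda>n. \<H>(itinerary p n) / real n) \<longlonglongrightarrow> h"
  shows "Limsup (at_right 0) (\<lambda>\<beta>. ereal (ln (real (covering_number M \<beta> \<delta>)) / (- ln \<beta>))) \<le> ereal (h / l)"
    (is "?L \<le> _")
proof (rule ccontr)
  assume "\<not> ?L \<le> ereal (h / l)"
  then obtain r where r: "ereal (h / l) < ereal r" "ereal r < ?L"
    using ereal_dense2[of "ereal (h / l)" ?L] by (auto simp: not_le)
  then have "h < r * l" using \<open>l > 0\<close> by (simp add: field_simps)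
  then have "\<forall>\<^sub>F n in sequentially. \<H>(itinerary p n) / real n < r * l"
    by (rule order_tendstoD(2)[OF h])
  then have "\<forall>\<^sub>F n in sequentially. n \<ge> 1 \<and> \<H>(itinerary p n) / real n < r * l"
    using eventually_ge_at_top[of 1] by eventually_elim auto
  then obtain k where k: "k \<ge> 1" "\<H>(itinerary p k) / real k < r * l"
    by (auto simp: eventually_sequentially)
  then have a: "\<H>(itinerary p k) < r * l * real k" by (simp add: field_simps)
  have "?L \<le> ereal (r * l * real k / (real k * l))"
    by (rule Limsup_covering_number_le_block[OF ergodic p fine null \<open>l > 0\<close> \<open>\<epsilon> > 0\<close> \<open>\<delta> > 0\<close> k(1) a])
  also have "r * l * real k / (real k * l) = r" using k \<open>l > 0\<close> by simp
  finally show False using r by simp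
qed

end

section \<open>The upper capacity as a supremum\<close>

lemma tendsto_at_right_antimono:
  fixes f :: "real \<Rightarrow> ereal"
  assumes anti: "\<And>x y. a < x \<Longrightarrow> x \<le> y \<Longrightarrow> f y \<le> f x"
  shows "(f \<longlongrightarrow> (SUP x\<in>{a<..}. f x)) (at_right a)"
proof (rule order_tendstoI)
  fix c assume "c < (SUP x\<in>{a<..}. f x)"
  then obtain x where x: "a < x" "c < f x" by (auto simp: less_SUP_iff)
  have "\<forall>\<^sub>F y in at_right a. y \<in> {a<..<x}" using x by (intro eventually_at_right_real)
  then show "\<forall>\<^sub>F y in at_right a. c < f y"
    by eventually_elim (use anti[of _ x] x in \<open>auto intro: less_le_trans\<close>)
next
  fix c assume c: "(SUP x\<in>{a<..}. f x) < c"
  have "\<forall>\<^sub>F y in at_right a. y > a" by (rule eventually_at_right_less)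
  then show "\<forall>\<^sub>F y in at_right a. f y < c"
    by eventually_elim (use c in \<open>auto intro: le_less_trans[OF SUP_upper]\<close>)
qed

text \<open>
  Compactness supplies a finite cover for \<open>\<delta>\<close>, so that the least number is attained; a cover that is
  admissible for \<open>\<delta>\<close> is admissible for \<open>\<delta>'\<close>.
\<close>

lemma covering_number_antimono:
  fixes M :: "'a::metric_space measure"
  assumes "compact (UNIV :: 'a set)" "prob_space M" "space M = UNIV"
    and "\<beta> > 0" "0 < \<delta>" "\<delta> \<le> \<delta>'"
  shows "covering_number M \<beta> \<delta>' \<le> covering_number M \<beta> \<delta>"
proof -
  define P where "P = (\<lambda>\<delta> n. \<exists>C A. finite C \<and> card C = n \<and> A \<in> sets borel \<and> measure M A \<ge> 1 - \<delta>
        \<and> A \<subseteq> (\<Union>x\<in>C. ball x \<beta>))"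
  obtain Q :: "'a set" where "finite Q" "UNIV \<subseteq> (\<Union>c\<in>Q. ball c \<beta>)"
    using compactE_image[OF assms(1), of UNIV "\<lambda>c. ball c \<beta>"] \<open>\<beta> > 0\<close>
    by (metis UNIV_I UN_I centre_in_ball open_ball subsetI)
  moreover have "measure M UNIV = 1" using prob_space.prob_space[OF assms(2)] assms(3) by simp
  ultimately have "P \<delta> (card Q)"
    unfolding P_def using \<open>0 < \<delta>\<close> by (intro exI[of _ Q] exI[of _ UNIV]) auto
  then have "P \<delta> (LEAST n. P \<delta> n)" by (rule LeastI)
  then have "P \<delta>' (LEAST n. P \<delta> n)"
    unfolding P_def using \<open>\<delta> \<le> \<delta>'\<close> by (smt (verit))
  then have "(LEAST n. P \<delta>' n) \<le> (LEAST n. P \<delta> n)" by (rule Least_le)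
  then show ?thesis by (simp add: covering_number_def P_def)
qed

lemma upper_capacity_eq_SUP:
  fixes M :: "'a::metric_space measure"
  assumes "compact (UNIV :: 'a set)" "prob_space M" "space M = UNIV"
  shows "upper_capacity M =
    (SUP \<delta>\<in>{0<..}. Limsup (at_right 0) (\<lambda>\<beta>. ereal (ln (real (covering_number M \<beta> \<delta>)) / (- ln \<beta>))))"
  unfolding upper_capacity_def
proof (rule tendsto_Lim[OF _ tendsto_at_right_antimono])
  fix \<delta> \<delta>' :: real assume \<delta>: "0 < \<delta>" "\<delta> \<le> \<delta>'"
  show "Limsup (at_right 0) (\<lambda>\<beta>. ereal (ln (real (covering_number M \<beta> \<delta>')) / (- ln \<beta>)))
      \<le> Limsup (at_right 0) (\<lambda>\<beta>. ereal (ln (real (covering_number M \<beta> \<delta>)) / (- ln \<beta>)))"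
  proof (rule Limsup_mono)
    have "\<forall>\<^sub>F \<beta>::real in at_right 0. \<beta> \<in> {0<..<1}" by (intro eventually_at_right_real) auto
    then show "\<forall>\<^sub>F \<beta> in at_right 0. ereal (ln (real (covering_number M \<beta> \<delta>')) / (- ln \<beta>))
        \<le> ereal (ln (real (covering_number M \<beta> \<delta>)) / (- ln \<beta>))"
    proof eventually_elim
      fix \<beta> :: real assume \<beta>: "\<beta> \<in> {0<..<1}"
      have le: "covering_number M \<beta> \<delta>' \<le> covering_number M \<beta> \<delta>"
        using \<beta> by (intro covering_number_antimono assms \<delta>) auto
      have "ln (real (covering_number M \<beta> \<delta>')) \<le> ln (real (covering_number M \<beta> \<delta>))"
      proof (cases "covering_number M \<beta> \<delta>' = 0")
        case True
        then show ?thesis by (cases "covering_number M \<beta> \<delta> = 0") auto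
      next
        case False
        then show ?thesis using le by (intro ln_mono) auto
      qed
      then show "ereal (ln (real (covering_number M \<beta> \<delta>')) / (- ln \<beta>))
          \<le> ereal (ln (real (covering_number M \<beta> \<delta>)) / (- ln \<beta>))"
        using \<beta> ln_less_zero[of \<beta>] unfolding ereal_less_eq by (intro divide_right_mono) auto
    qed
  qed
qed simp

lemma upper_capacity_nonneg:
  fixes M :: "'a::metric_space measure"
  assumes "compact (UNIV :: 'a set)" "prob_space M" "space M = UNIV"
  shows "0 \<le> upper_capacity M"
proof -
  have "0 \<le> Limsup (at_right 0) (\<lambda>\<beta>. ereal (ln (real (covering_number M \<beta> 1)) / (- ln \<beta>)))"
  proof (rule le_Limsup)
    have "\<forall>\<^sub>F \<beta>::real in at_right 0. \<beta> \<in> {0<..<1}" by (intro eventually_at_right_real) auto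
    then show "\<forall>\<^sub>F \<beta> in at_right 0. 0 \<le> ereal (ln (real (covering_number M \<beta> 1)) / (- ln \<beta>))"
    proof eventually_elim
      fix \<beta> :: real assume "\<beta> \<in> {0<..<1}"
      then have "- ln \<beta> \<ge> 0" using ln_less_zero[of \<beta>] by auto
      moreover have "ln (real (covering_number M \<beta> 1)) \<ge> 0"
        by (cases "covering_number M \<beta> 1 = 0") auto
      ultimately show "0 \<le> ereal (ln (real (covering_number M \<beta> 1)) / (- ln \<beta>))"
        unfolding zero_ereal_def ereal_less_eq by (intro divide_nonneg_nonneg)
    qed
  qed simp
  also have "\<dots> \<le> upper_capacity M"
    unfolding upper_capacity_eq_SUP[OF assms] by (rule SUP_upper) simp
  finally show ?thesis .
qed

section \<open>Entropy, capacity and expansion\<close>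

text \<open>
  The bound for one admissible rate of expansion. The witness \<open>h\<close> is the entropy of \<open>T\<close> with respect to a
  partition into sets of diameter at most \<open>\<epsilon>\<close>. It is a real number, and so the capacity is finite as soon
  as there is a positive rate.
\<close>

lemma (in borel_measure_preserving_map) upper_capacity_le_entropy_div:
  assumes compact: "compact (UNIV :: 'a set)"
    and ergodic: "\<And>A. A \<in> sets M \<Longrightarrow> T -` A = A \<Longrightarrow> prob A = 0 \<or> prob A = 1"
    and null: "\<forall>x. prob (slow_set T l \<epsilon> x) = 0" and "l > 0" and "\<epsilon> > 0"
  shows "\<exists>h. ereal h \<le> KS_entropy M T \<and> upper_capacity M \<le> ereal (h / l)"
proof -
  obtain \<alpha> :: "'a set set" where \<alpha>: "finite_borel_partition \<alpha>"
    and small: "\<forall>A\<in>\<alpha>. \<forall>x\<in>A. \<forall>y\<in>A. dist x y < \<epsilon>"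
    using exists_fine_partition[OF compact \<open>\<epsilon> > 0\<close>] by (elim exE conjE)
  have fine: "dist x y < \<epsilon>" if "cell \<alpha> x = cell \<alpha> y" for x y
  proof -
    have "x \<in> cell \<alpha> x" "y \<in> cell \<alpha> x"
      using mem_iff_cell_eq[OF \<alpha> cell_mem[OF \<alpha>, of x]] that by simp_all
    then show ?thesis using small cell_mem[OF \<alpha>, of x] by blast
  qed
  obtain h where h: "(\<lambda>n. \<H>(itinerary (cell \<alpha>) n) / real n) \<longlonglongrightarrow> h" "0 \<le> h" "ereal h \<le> KS_entropy M T"
    by (rule KS_entropy_ge[OF \<alpha>])
  have "upper_capacity M \<le> ereal (h / l)"
    unfolding upper_capacity_eq_SUP[OF compact prob_space_axioms space_M]
  proof (rule SUP_least)
    fix \<delta> :: real assume "\<delta> \<in> {0<..}"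
    then have "\<delta> > 0" by simp
    show "Limsup (at_right 0) (\<lambda>\<beta>. ereal (ln (real (covering_number M \<beta> \<delta>)) / (- ln \<beta>))) \<le> ereal (h / l)"
      by (rule Limsup_covering_number_le[OF ergodic simple_function_cell[OF \<alpha>] fine
          null[rule_format] \<open>l > 0\<close> \<open>\<epsilon> > 0\<close> \<open>\<delta> > 0\<close> h(1)])
  qed
  with h(3) show ?thesis by blast
qed

theorem theoremC:
  fixes T :: "'a::metric_space \<Rightarrow> 'a" and \<mu> :: "'a measure"
  assumes "compact (UNIV :: 'a set)"
    and "continuous_on UNIV T"
    and "prob_space \<mu>"
    and "sets \<mu> = sets borel"
    and "invariant_measure T \<mu>"
    and "ergodic_measure T \<mu>"
  shows "KS_entropy \<mu> T \<ge> upper_capacity \<mu> * expansion_exponent \<mu> T"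
proof -
  have space: "space \<mu> = UNIV" using sets_eq_imp_space_eq[OF assms(4)] by simp
  have "T \<in> borel_measurable borel" by (rule borel_measurable_continuous_onI[OF assms(2)])
  then have T: "T \<in> measurable \<mu> \<mu>"
    using measurable_cong_sets[OF assms(4) assms(4)] by simp
  interpret prob_space \<mu> by fact
  have "distr \<mu> \<mu> T = \<mu>"
  proof (rule measure_eqI)
    fix A assume "A \<in> sets (distr \<mu> \<mu> T)"
    then have A: "A \<in> sets \<mu>" by simp
    then show "emeasure (distr \<mu> \<mu> T) A = emeasure \<mu> A"
      using assms(4,5) T
      by (simp add: emeasure_distr emeasure_eq_measure invariant_measure_def space)
  qed simp
  then interpret borel_measure_preserving_map \<mu> T
    by unfold_locales (use space T assms(4) in auto)
  have ergodic: "prob A = 0 \<or> prob A = 1" if "A \<in> sets \<mu>" "T -` A = A" for A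
    using assms(4,6) that by (auto simp: ergodic_measure_def)
  define S where "S = {ereal l | l. \<exists>\<epsilon>>0. \<forall>x. prob (slow_set T l \<epsilon> x) = 0}"
  have exponent: "expansion_exponent \<mu> T = Sup S"
    by (simp add: expansion_exponent_def S_def slow_set_def)
  note cap_nonneg = upper_capacity_nonneg[OF assms(1,3) space]
  have "finite_borel_partition {UNIV :: 'a set}"
    by (simp add: finite_borel_partition_def)
  from KS_entropy_ge[OF this] have KS_nonneg: "0 \<le> KS_entropy \<mu> T"
    by (metis ereal_less_eq(5) order_trans)
  have rate: "\<exists>h. ereal h \<le> KS_entropy \<mu> T \<and> upper_capacity \<mu> \<le> ereal (h / l)"
    if "ereal l \<in> S" "l > 0" for l
  proof -
    from that obtain \<epsilon> where \<epsilon>: "\<epsilon> > 0" "\<forall>x. prob (slow_set T l \<epsilon> x) = 0"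
      by (auto simp: S_def)
    show ?thesis
      by (rule upper_capacity_le_entropy_div[OF assms(1) ergodic \<epsilon>(2) \<open>l > 0\<close> \<epsilon>(1)])
  qed
  \<comment> \<open>Separating this case keeps products of 0 with infinite values out of the division below.\<close>
  show ?thesis
  proof (cases "upper_capacity \<mu> = 0 \<or> Sup S \<le> 0")
    case True
    then have "upper_capacity \<mu> * Sup S \<le> 0"
      using cap_nonneg by (auto simp: ereal_mult_le_0_iff)
    then show ?thesis using KS_nonneg exponent by (auto intro: order_trans)
  next
    case False
    then obtain e where e: "e \<in> S" "0 < e" by (auto simp: not_le less_Sup_iff)
    then obtain l0 where "e = ereal l0" unfolding S_def by blast
    with e have "ereal l0 \<in> S" "l0 > 0" by simp_all
    from rate[OF this] False cap_nonneg obtain c where c: "upper_capacity \<mu> = ereal c" "c > 0"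
      by (cases "upper_capacity \<mu>") auto
    have "Sup S \<le> KS_entropy \<mu> T / ereal c"
    proof (rule Sup_least)
      fix e assume "e \<in> S"
      then obtain l where l: "e = ereal l" "ereal l \<in> S" by (auto simp: S_def)
      have "ereal c * ereal l \<le> KS_entropy \<mu> T"
      proof (cases "l > 0")
        case True
        with rate[OF l(2)] c obtain h where h: "ereal h \<le> KS_entropy \<mu> T" "c \<le> h / l" by auto
        then have "ereal c * ereal l \<le> ereal h" using True by (simp add: field_simps)
        with h(1) show ?thesis by (rule order_trans[rotated])
      next
        case False
        then have "ereal c * ereal l \<le> 0" using c by (simp add: mult_nonneg_nonpos)
        then show ?thesis using KS_nonneg by (rule order_trans)
      qed
      then show "e \<le> KS_entropy \<mu> T / ereal c" using c l by (simp add: ereal_le_divide_pos)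
    qed
    then show ?thesis using c exponent by (simp add: ereal_le_divide_pos)
  qed
qed

end
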